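(* Let $\phi\in L^2(\mathbb{R}^d)$, let $\Phi=|\hat\phi|^2$, and let $\{\lambda_k\}_{k\in\mathbb{Z}}$ be a sequence in $\mathbb{R}^d$. If $\{T_{\lambda_k}\phi\}_{k\in\mathbb{Z}}$ is a Bessel sequence, then $$\sup_{k\in\mathbb{Z}}\sum_{l\in\mathbb{Z}}\left|\hat\Phi(\lambda_k-\lambda_l)\right|^2<\infty.$$
   Context: Fourier transform: $\hat f(w)=\int_{\mathbb{R}^d}f(x)e^{-2\pi i x\cdot w}\,dx$, extended to $L^2(\mathbb{R}^d)$; $\Phi\in L^1(\mathbb{R}^d)$, so $\hat\Phi$ is given by the integral pointwise. $T_\lambda f(x)=f(x-\lambda)$. A sequence $\{\psi_k\}$ in a Hilbert space $\mathcal{H}$ (here $L^2(\mathbb{R}^d)$) is a Bessel sequence if there is $B>0$ with $\sum_k|\langle f,\psi_k\rangle|^2\le B\|f\|^2$ for all $f\in\mathcal{H}$. *)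

theory Defs
  imports "HOL-Analysis.Analysis"
begin

text \<open>
  Elements of $L^2$ are represented by functions rather than by classes modulo equality almost
  everywhere. Restricting to Borel functions loses nothing, since every Lebesgue measurable
  function agrees almost everywhere with a Borel measurable one.
\<close>

definition L2 :: "('a::euclidean_space \<Rightarrow> complex) set" where
  "L2 = {f. f \<in> borel_measurable lborel \<and> integrable lborel (\<lambda>x. (cmod (f x))\<^sup>2)}"

definition L2_inner :: "('a::euclidean_space \<Rightarrow> complex) \<Rightarrow> ('a \<Rightarrow> complex) \<Rightarrow> complex" where
  "L2_inner f g = (LINT x|lborel. f x * cnj (g x))"

definition L2_norm :: "('a::euclidean_space \<Rightarrow> complex) \<Rightarrow> real" where
  "L2_norm f = sqrt (LINT x|lborel. (cmod (f x))\<^sup>2)"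

definition translate :: "'a::euclidean_space \<Rightarrow> ('a \<Rightarrow> complex) \<Rightarrow> 'a \<Rightarrow> complex" where
  "translate a f = (\<lambda>x. f (x - a))"

text \<open>
  The sum is taken in \<^typ>\<open>ennreal\<close>, so the inequality includes its convergence.
\<close>

definition Bessel_sequence :: "('k \<Rightarrow> 'a::euclidean_space \<Rightarrow> complex) \<Rightarrow> bool" where
  "Bessel_sequence \<psi> \<longleftrightarrow>
     (\<forall>k. \<psi> k \<in> L2) \<and>
     (\<exists>B>0. \<forall>f\<in>L2.
        (\<Sum>\<^sub>\<infinity>k\<in>UNIV. ennreal ((cmod (L2_inner f (\<psi> k)))\<^sup>2)) \<le> ennreal (B * (L2_norm f)\<^sup>2))"

definition fourier_L1 :: "('a::euclidean_space \<Rightarrow> complex) \<Rightarrow> 'a \<Rightarrow> complex" where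
  "fourier_L1 f w =
     (LINT x|lborel. f x * exp (- (2 * complex_of_real pi * \<i> * complex_of_real (x \<bullet> w))))"

text \<open>
  The continuous extension of the Fourier integral from $L^1 \cap L^2$ to $L^2$, as the closure of
  its graph in $L^2 \times L^2$. By Plancherel, every \<open>f \<in> L2\<close> has a transform \<open>g\<close>, unique up to
  equality almost everywhere; \<open>fourier_L2\<close> picks one such representative.
\<close>

definition is_fourier_L2 :: "('a::euclidean_space \<Rightarrow> complex) \<Rightarrow> ('a \<Rightarrow> complex) \<Rightarrow> bool" where
  "is_fourier_L2 f g \<longleftrightarrow>
     f \<in> L2 \<and> g \<in> L2 \<and>
     (\<exists>u :: nat \<Rightarrow> 'a \<Rightarrow> complex.
        (\<forall>n. u n \<in> L2 \<and> integrable lborel (u n) \<and> fourier_L1 (u n) \<in> L2) \<and>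
        (\<lambda>n. L2_norm (\<lambda>x. u n x - f x)) \<longlonglongrightarrow> 0 \<and>
        (\<lambda>n. L2_norm (\<lambda>w. fourier_L1 (u n) w - g w)) \<longlonglongrightarrow> 0)"

definition fourier_L2 :: "('a::euclidean_space \<Rightarrow> complex) \<Rightarrow> 'a \<Rightarrow> complex" where
  "fourier_L2 f = (SOME g. is_fourier_L2 f g)"

end

(*
  With g the transform of phi, the transform of |g|^2 at lam k - lam l is the inner product of the
  modulations of g by lam k and lam l. The multiplication formula, the integral of f^ h equals that
  of f h^, moves the transform off the second factor, so this number is the inner product of some f
  in L^2 with the translate of phi by lam l, and the Bessel inequality applies to f. Since f is
  obtained from phi by two transforms, its norm is at most that of phi, uniformly in k. Thus
  Plancherel's equality is not needed, only the inequality, which follows from Gaussian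
  regularisation and Fatou's lemma.
*)
theory Submission
  imports Defs "HOL-Probability.Characteristic_Functions"
begin

text \<open>The modulation of g by lam k is a transform of the translate of phi by lam k, so Fourier
  inversion would identify f with that translate and the sum over l with a row of the Gram matrix of
  the translates. Here f is instead written down by the formula for the inverse transform, the
  conjugate of the transform of the conjugate. With this choice its inner products come straight
  from the multiplication formula, and only a norm bound remains. The other obstacle is that
  \<open>fourier_L2\<close> is a choice from the closure of a graph: nothing is known about it until
  some transform is shown to exist. Existence rests on Plancherel's inequality, which makes the
  transforms of truncations a Cauchy sequence, and on completeness of L^2, proved for functions
  rather than classes. The properties of the transform on L^2 are then stated for the relation
  \<open>is_fourier_L2\<close>, so they hold for every representative.\<close>

section \<open>Square-integrable functions: norms and the bilinear pairing\<close>

text \<open>The value in \<open>ennreal\<close> is meaningful before membership in \<open>L2\<close>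
  is known: for a measurable function outside \<open>L2\<close> it is infinite, whereas
  \<open>L2_norm\<close> falls back to 0 because the Bochner integral does.\<close>

definition nnsq :: "('a::euclidean_space \<Rightarrow> complex) \<Rightarrow> ennreal" where
  "nnsq f = (\<integral>\<^sup>+x. ennreal ((cmod (f x))\<^sup>2) \<partial>lborel)"

lemma L2_iff_nnsq: "f \<in> L2 \<longleftrightarrow> f \<in> borel_measurable borel \<and> nnsq f < \<infinity>"
  by (auto simp: L2_def nnsq_def integrable_iff_bounded)

lemma L2_measurable [measurable_dest]: "f \<in> L2 \<Longrightarrow> f \<in> borel_measurable borel"
  by (simp add: L2_iff_nnsq)

lemma L2_norm_nonneg [simp]: "0 \<le> L2_norm f"
  by (simp add: L2_norm_def)

lemma nnsq_eq_L2_norm: "f \<in> L2 \<Longrightarrow> nnsq f = ennreal ((L2_norm f)\<^sup>2)"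
  by (simp add: L2_def nnsq_def L2_norm_def nn_integral_eq_integral)

lemma tendsto_L2_norm_zero_iff:
  assumes "\<And>n. f n \<in> L2"
  shows "(\<lambda>n. L2_norm (f n)) \<longlonglongrightarrow> 0 \<longleftrightarrow> (\<lambda>n. nnsq (f n)) \<longlonglongrightarrow> 0"
proof -
  have "(\<lambda>n. nnsq (f n)) \<longlonglongrightarrow> 0 \<longleftrightarrow> (\<lambda>n. ennreal ((L2_norm (f n))\<^sup>2)) \<longlonglongrightarrow> ennreal 0"
    by (simp add: nnsq_eq_L2_norm assms)
  also have "\<dots> \<longleftrightarrow> (\<lambda>n. (L2_norm (f n))\<^sup>2) \<longlonglongrightarrow> 0"
    by (rule tendsto_ennreal_iff) simp_all
  also have "\<dots> \<longleftrightarrow> (\<lambda>n. L2_norm (f n)) \<longlonglongrightarrow> 0"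
    by simp
  finally show ?thesis ..
qed

text \<open>A cheap substitute for Minkowski's inequality that avoids square roots in
  \<open>ennreal\<close>; the factor 2 is harmless where only finiteness or smallness is
  wanted.\<close>

lemma nnsq_add_le:
  assumes [measurable]: "f \<in> borel_measurable borel" "g \<in> borel_measurable borel"
  shows "nnsq (\<lambda>x. f x + g x) \<le> 2 * nnsq f + 2 * nnsq g"
proof -
  have "(cmod (f x + g x))\<^sup>2 \<le> 2 * (cmod (f x))\<^sup>2 + 2 * (cmod (g x))\<^sup>2" for x
  proof -
    have "(cmod (f x + g x))\<^sup>2 \<le> (cmod (f x) + cmod (g x))\<^sup>2"
      by (intro power_mono norm_triangle_ineq) simp
    \<comment> \<open>The right side exceeds (|f| + |g|)^2 by exactly (|f| - |g|)^2.\<close>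
    with zero_le_power2[of "cmod (f x) - cmod (g x)"] show ?thesis
      by (simp add: power2_eq_square algebra_simps)
  qed
  then have "nnsq (\<lambda>x. f x + g x) \<le>
      (\<integral>\<^sup>+x. ennreal (2 * (cmod (f x))\<^sup>2 + 2 * (cmod (g x))\<^sup>2) \<partial>lborel)"
    unfolding nnsq_def by (intro nn_integral_mono ennreal_leI)
  also have "\<dots> = 2 * nnsq f + 2 * nnsq g"
    unfolding nnsq_def
    by (simp add: ennreal_plus ennreal_mult nn_integral_add nn_integral_cmult)
  finally show ?thesis .
qed

lemma nnsq_diff_le:
  assumes "f \<in> borel_measurable borel" "g \<in> borel_measurable borel"
  shows "nnsq (\<lambda>x. f x - g x) \<le> 2 * nnsq f + 2 * nnsq g"
  using nnsq_add_le[of f "\<lambda>x. - g x"] assms by (simp add: nnsq_def)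

lemma L2_diff: "f \<in> L2 \<Longrightarrow> g \<in> L2 \<Longrightarrow> (\<lambda>x. f x - g x) \<in> L2"
  using le_less_trans[OF nnsq_diff_le[of f g], of \<infinity>]
  by (simp add: L2_iff_nnsq ennreal_mult_less_top borel_measurable_diff)

lemma L2_cnj: "f \<in> L2 \<Longrightarrow> (\<lambda>x. cnj (f x)) \<in> L2"
  using measurable_compose[OF _ borel_measurable_continuous_onI[OF continuous_on_cnj[OF continuous_on_id]],
      of f lborel]
  by (simp add: L2_def)

lemma L2_bounded_mult:
  assumes f: "f \<in> L2" and [measurable]: "h \<in> borel_measurable borel"
    and le: "\<And>x. cmod (h x) \<le> 1"
  shows "(\<lambda>x. h x * f x) \<in> L2" "nnsq (\<lambda>x. h x * f x) \<le> nnsq f"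
proof -
  note [measurable] = L2_measurable[OF f]
  show *: "nnsq (\<lambda>x. h x * f x) \<le> nnsq f"
    unfolding nnsq_def
    by (intro nn_integral_mono ennreal_leI power_mono) (auto simp: norm_mult mult_left_le_one_le le)
  show "(\<lambda>x. h x * f x) \<in> L2"
    using f * by (auto simp: L2_iff_nnsq intro: le_less_trans)
qed

lemma L2_mult_integrable:
  assumes f: "f \<in> L2" and g: "g \<in> L2"
  shows "integrable lborel (\<lambda>x. f x * g x)"
proof (rule Bochner_Integration.integrable_bound)
  show "integrable lborel (\<lambda>x. (cmod (f x))\<^sup>2 + (cmod (g x))\<^sup>2)"
    using f g by (simp add: L2_def)
  note [measurable] = L2_measurable[OF f] L2_measurable[OF g]
  show "(\<lambda>x. f x * g x) \<in> borel_measurable lborel" by measurable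
  have "cmod (f x) * cmod (g x) \<le> (cmod (f x))\<^sup>2 + (cmod (g x))\<^sup>2" for x
    using sum_squares_bound[of "cmod (f x)" "cmod (g x)"]
      mult_nonneg_nonneg[OF norm_ge_zero[of "f x"] norm_ge_zero[of "g x"]]
    by linarith
  then show "AE x in lborel. norm (f x * g x) \<le> norm ((cmod (f x))\<^sup>2 + (cmod (g x))\<^sup>2)"
    by (simp add: norm_mult)
qed

lemma L2_Cauchy_Schwarz:
  assumes f: "f \<in> L2" and g: "g \<in> L2"
  shows "cmod (LINT x|lborel. f x * g x) \<le> L2_norm f * L2_norm g"
proof -
  note [measurable] = L2_measurable[OF f] L2_measurable[OF g]
  let ?I = "\<integral>\<^sup>+x. ennreal (cmod (f x)) * ennreal (cmod (g x)) \<partial>lborel"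
  have "ennreal (cmod (LINT x|lborel. f x * g x)) \<le> ?I"
    using integral_norm_bound_ennreal[OF L2_mult_integrable[OF f g]]
    by (simp add: norm_mult ennreal_mult)
  then have "(ennreal (cmod (LINT x|lborel. f x * g x)))\<^sup>2 \<le> ?I\<^sup>2"
    by (intro power_mono) auto
  also have "\<dots> \<le> nnsq f * nnsq g"
    using Cauchy_Schwarz_nn_integral[of "\<lambda>x. ennreal (cmod (f x))" lborel "\<lambda>x. ennreal (cmod (g x))"]
    by (simp add: nnsq_def ennreal_power)
  also have "\<dots> = ennreal ((L2_norm f * L2_norm g)\<^sup>2)"
    by (simp add: f g nnsq_eq_L2_norm ennreal_mult power_mult_distrib)
  finally have "(cmod (LINT x|lborel. f x * g x))\<^sup>2 \<le> (L2_norm f * L2_norm g)\<^sup>2"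
    by (simp add: ennreal_power)
  then show ?thesis
    by (rule power2_le_imp_le) simp
qed

text \<open>The pairing carries no conjugate, as it is meant for the two sides of the multiplication
  formula. Expanding the difference around the limits \<open>F\<close> and \<open>G\<close> leaves
  three terms for Cauchy-Schwarz, and only the norms of the limits occur as factors, so no uniform
  bound on the sequences has to be found first.\<close>

lemma tendsto_L2_pairing:
  assumes L2: "\<And>n. f n \<in> L2" "\<And>n. g n \<in> L2" "F \<in> L2" "G \<in> L2"
    and f: "(\<lambda>n. L2_norm (\<lambda>x. f n x - F x)) \<longlonglongrightarrow> 0"
    and g: "(\<lambda>n. L2_norm (\<lambda>x. g n x - G x)) \<longlonglongrightarrow> 0"
  shows "(\<lambda>n. LINT x|lborel. f n x * g n x) \<longlonglongrightarrow> (LINT x|lborel. F x * G x)"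
proof (rule LIM_zero_cancel, rule Lim_null_comparison)
  let ?a = "\<lambda>n. L2_norm (\<lambda>x. f n x - F x)" and ?b = "\<lambda>n. L2_norm (\<lambda>x. g n x - G x)"
  show "(\<lambda>n. ?a n * L2_norm G + (L2_norm F * ?b n + ?a n * ?b n)) \<longlonglongrightarrow> 0"
    by (intro tendsto_add_zero tendsto_mult_zero tendsto_mult_left_zero tendsto_mult_right_zero f g)
  have "norm ((LINT x|lborel. f n x * g n x) - (LINT x|lborel. F x * G x))
      \<le> ?a n * L2_norm G + (L2_norm F * ?b n + ?a n * ?b n)" for n
  proof -
    note df = L2_diff[OF L2(1,3), of n] and dg = L2_diff[OF L2(2,4), of n]
    have "(LINT x|lborel. f n x * g n x) - (LINT x|lborel. F x * G x) =
        (LINT x|lborel. f n x * g n x - F x * G x)"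
      using L2 by (simp add: L2_mult_integrable)
    also have "\<dots> = (LINT x|lborel. (f n x - F x) * G x +
        (F x * (g n x - G x) + (f n x - F x) * (g n x - G x)))"
      by (intro Bochner_Integration.integral_cong) (simp_all add: algebra_simps)
    also have "\<dots> = (LINT x|lborel. (f n x - F x) * G x) +
        ((LINT x|lborel. F x * (g n x - G x)) + (LINT x|lborel. (f n x - F x) * (g n x - G x)))"
      by (simp add: L2_mult_integrable L2 df dg)
    finally show ?thesis
      by (simp only:) (intro norm_triangle_mono L2_Cauchy_Schwarz L2 df dg)
  qed
  then show "\<forall>\<^sub>F n in sequentially. norm ((LINT x|lborel. f n x * g n x) -
      (LINT x|lborel. F x * G x)) \<le> ?a n * L2_norm G + (L2_norm F * ?b n + ?a n * ?b n)"
    by (intro always_eventually allI)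
qed

section \<open>Fatou's lemma and completeness of L^2\<close>

lemma nnsq_le_liminf:
  assumes [measurable]: "\<And>n. f n \<in> borel_measurable borel"
    and lim: "AE x in lborel. (\<lambda>n. f n x) \<longlonglongrightarrow> g x"
  shows "nnsq g \<le> liminf (\<lambda>n. nnsq (f n))"
proof -
  have "nnsq g = (\<integral>\<^sup>+x. liminf (\<lambda>n. ennreal ((cmod (f n x))\<^sup>2)) \<partial>lborel)"
    unfolding nnsq_def
  proof (intro nn_integral_cong_AE)
    from lim show "AE x in lborel.
        ennreal ((cmod (g x))\<^sup>2) = liminf (\<lambda>n. ennreal ((cmod (f n x))\<^sup>2))"
    proof eventually_elim
      case (elim x)
      then have "(\<lambda>n. ennreal ((cmod (f n x))\<^sup>2)) \<longlonglongrightarrow> ennreal ((cmod (g x))\<^sup>2)"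
        by (intro tendsto_intros)
      then show ?case
        by (intro lim_imp_Liminf[symmetric]) auto
    qed
  qed
  also have "\<dots> \<le> liminf (\<lambda>n. nnsq (f n))"
    unfolding nnsq_def by (rule nn_integral_liminf) measurable
  finally show ?thesis .
qed

lemma ennreal_le_suminf: "f k \<le> (\<Sum>n. f n :: ennreal)"
  using sum_le_suminf[of f "{k}"] by simp

text \<open>The weights \<open>4 ^ n\<close> make the differences of a fast subsequence summable almost everywhere.\<close>

lemma L2_complete:
  assumes L2: "\<And>n. f n \<in> L2"
    and Cauchy: "\<And>e. 0 < e \<Longrightarrow> \<exists>N. \<forall>m\<ge>N. \<forall>n\<ge>N. nnsq (\<lambda>x. f m x - f n x) \<le> ennreal e"
  obtains g where "g \<in> L2" "(\<lambda>n. L2_norm (\<lambda>x. f n x - g x)) \<longlonglongrightarrow> 0"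
proof -
  note [measurable] = L2_measurable[OF L2]
  \<comment> \<open>The rate 8^-k beats the weight 4^k and leaves the summable 2^-k. Where the
    weighted series is finite, its k-th term bounds the squared difference by a multiple of 4^-k,
    hence the difference by a multiple of 2^-k.\<close>
  have "\<forall>k. \<exists>N. \<forall>m\<ge>N. \<forall>n\<ge>N. nnsq (\<lambda>x. f m x - f n x) \<le> ennreal ((1/8) ^ k)"
    using Cauchy by simp
  then obtain N where N: "\<And>k m n. N k \<le> m \<Longrightarrow> N k \<le> n \<Longrightarrow>
      nnsq (\<lambda>x. f m x - f n x) \<le> ennreal ((1/8) ^ k)"
    by metis
  \<comment> \<open>The sum dominates every \<open>N i\<close> with i <= k, although
    \<open>N\<close> need not be monotone; the summand \<open>k\<close> forces \<open>r\<close> to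
    infinity.\<close>
  define r where "r k = (\<Sum>i\<le>k. N i) + k" for k
  have r_N: "N k \<le> r j" if "k \<le> j" for k j
    using that member_le_sum[of k "{..j}" N] by (auto simp: r_def)
  have r_lim: "filterlim r at_top sequentially"
    by (rule filterlim_at_top_mono[OF filterlim_ident]) (simp add: r_def)
  let ?d = "\<lambda>k x. f (r (Suc k)) x - f (r k) x"
  have "(\<integral>\<^sup>+x. (\<Sum>k. ennreal (4 ^ k * (cmod (?d k x))\<^sup>2)) \<partial>lborel) =
      (\<Sum>k. ennreal (4 ^ k) * nnsq (?d k))"
    unfolding nnsq_def
    by (subst nn_integral_suminf) (simp_all add: ennreal_mult nn_integral_cmult)
  also have "\<dots> \<le> (\<Sum>k. ennreal (4 ^ k) * ennreal ((1/8) ^ k))"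
    by (intro suminf_le mult_left_mono N) (auto intro: r_N)
  also have "\<dots> = (\<Sum>k. ennreal ((1/2) ^ k))"
    by (simp flip: ennreal_mult power_mult_distrib)
  also have "\<dots> < \<infinity>"
    by (subst suminf_ennreal2) (simp_all add: summable_geometric)
  finally have "AE x in lborel. (\<Sum>k. ennreal (4 ^ k * (cmod (?d k x))\<^sup>2)) \<noteq> \<infinity>"
    by (intro nn_integral_PInf_AE) (auto)
  then have conv: "AE x in lborel. convergent (\<lambda>k. f (r k) x)"
  proof eventually_elim
    case (elim x)
    define S where "S = (\<Sum>k. ennreal (4 ^ k * (cmod (?d k x))\<^sup>2))"
    with elim have "S \<noteq> \<infinity>"
      by metis
    then obtain C where C: "0 \<le> C" "S = ennreal C"
      by (cases S) auto
    have le: "cmod (?d k x) \<le> sqrt C * (1/2) ^ k" for k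
    proof -
      have "ennreal (4 ^ k * (cmod (?d k x))\<^sup>2) \<le> ennreal C"
        unfolding C(2)[symmetric] S_def by (rule ennreal_le_suminf)
      then have "4 ^ k * (cmod (?d k x))\<^sup>2 \<le> C"
        by (simp add: C)
      moreover have "4 ^ k * (cmod (?d k x))\<^sup>2 = (2 ^ k * cmod (?d k x))\<^sup>2"
        by (simp add: power_mult_distrib) (simp add: power2_eq_square flip: power_mult_distrib)
      ultimately have "2 ^ k * cmod (?d k x) \<le> sqrt C"
        by (simp add: real_le_rsqrt)
      then have "(2 ^ k * cmod (?d k x)) * (1/2) ^ k \<le> sqrt C * (1/2) ^ k"
        by (rule mult_right_mono) simp
      then show ?thesis
        by (simp add: power_one_over)
    qed
    have "summable (\<lambda>k. sqrt C * (1/2) ^ k)"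
      by (intro summable_mult summable_geometric) simp
    then have "summable (\<lambda>k. ?d k x)"
      by (rule summable_comparison_test') (rule le)
    then have "convergent (\<lambda>n. f (r n) x - f (r 0) x)"
      unfolding summable_iff_convergent sum_lessThan_telescope[of "\<lambda>k. f (r k) x"] .
    then show ?case
      by (simp only: convergent_diff_const_right_iff)
  qed
  \<comment> \<open>Where the subsequence diverges, \<open>lim\<close> has an unspecified value, but
    this happens only on a null set.\<close>
  define g where "g x = lim (\<lambda>k. f (r k) x)" for x
  have [measurable]: "g \<in> borel_measurable borel"
    unfolding g_def by measurable
  have lim: "AE x in lborel. (\<lambda>k. f (r k) x) \<longlonglongrightarrow> g x"
    using conv by eventually_elim (simp add: g_def convergent_LIMSEQ_iff)
  \<comment> \<open>Sending one index of the Cauchy estimate to infinity along \<open>r\<close>, by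
    Fatou, controls the whole sequence and not just the subsequence.\<close>
  have bound: "nnsq (\<lambda>x. f n x - g x) \<le> ennreal e"
    if "\<And>m n. N \<le> m \<Longrightarrow> N \<le> n \<Longrightarrow> nnsq (\<lambda>x. f m x - f n x) \<le> ennreal e" "N \<le> n" for N n e
  proof -
    have "nnsq (\<lambda>x. f n x - g x) \<le> liminf (\<lambda>k. nnsq (\<lambda>x. f n x - f (r k) x))"
      using lim by (intro nnsq_le_liminf) (auto elim!: eventually_mono intro!: tendsto_intros)
    also have "\<dots> \<le> limsup (\<lambda>k. nnsq (\<lambda>x. f n x - f (r k) x))"
      by (rule Liminf_le_Limsup) simp
    also have "\<dots> \<le> ennreal e"
    proof (rule Limsup_bounded)
      show "\<forall>\<^sub>F k in sequentially. nnsq (\<lambda>x. f n x - f (r k) x) \<le> ennreal e"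
        using r_lim[unfolded filterlim_at_top, rule_format, of N]
        by eventually_elim (use that in auto)
    qed
    finally show ?thesis .
  qed
  \<comment> \<open>At k = 0 the rate is (1/8)^0 = 1: not small, but finite, which is enough to
    recover \<open>g\<close> as f - (f - g).\<close>
  have diff_L2: "(\<lambda>x. f n x - g x) \<in> L2" if "N 0 \<le> n" for n
    using bound[of "N 0" 1 n] N[of 0] that
    by (auto simp: L2_iff_nnsq intro: le_less_trans)
  have g: "g \<in> L2"
    using L2_diff[OF L2[of "N 0"] diff_L2[OF order_refl]] by simp
  show ?thesis
  proof (rule that[OF g])
    have "(\<lambda>n. nnsq (\<lambda>x. f n x - g x)) \<longlonglongrightarrow> 0"
    proof (rule tendsto_zero_ennreal)
      fix e :: real assume "0 < e"
      then obtain M where M: "\<forall>m\<ge>M. \<forall>n\<ge>M. nnsq (\<lambda>x. f m x - f n x) \<le> ennreal (e/2)"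
        using Cauchy[of "e/2"] by (meson half_gt_zero)
      have "nnsq (\<lambda>x. f n x - g x) < ennreal e" if "M \<le> n" for n
      proof (rule le_less_trans)
        show "nnsq (\<lambda>x. f n x - g x) \<le> ennreal (e/2)"
          using M by (intro bound[OF _ that]) blast
        show "ennreal (e/2) < ennreal e"
          using \<open>0 < e\<close> by (intro ennreal_lessI) simp_all
      qed
      then show "\<forall>\<^sub>F n in sequentially. nnsq (\<lambda>x. f n x - g x) < ennreal e"
        unfolding eventually_sequentially by blast
    qed
    then show "(\<lambda>n. L2_norm (\<lambda>x. f n x - g x)) \<longlonglongrightarrow> 0"
      by (simp add: tendsto_L2_norm_zero_iff L2_diff L2 g)
  qed
qed

section \<open>The Fourier integral on L^1 and the multiplication formula\<close>

definition fchar :: "real \<Rightarrow> complex" where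
  "fchar t = exp (- (2 * complex_of_real pi * \<i> * complex_of_real t))"

lemma fourier_L1_fchar: "fourier_L1 f w = (LINT x|lborel. f x * fchar (x \<bullet> w))"
  by (simp add: fourier_L1_def fchar_def)

lemma norm_fchar [simp]: "cmod (fchar t) = 1"
  by (simp add: fchar_def)

lemma fchar_add: "fchar (s + t) = fchar s * fchar t"
  by (simp add: fchar_def flip: exp_add) (simp add: algebra_simps)

lemma fchar_0 [simp]: "fchar 0 = 1"
  by (simp add: fchar_def)

lemma cnj_fchar: "cnj (fchar t) = fchar (- t)"
  by (simp add: fchar_def exp_cnj)

lemma fchar_sum: "finite A \<Longrightarrow> fchar (\<Sum>i\<in>A. f i) = (\<Prod>i\<in>A. fchar (f i))"
  by (induction A rule: finite_induct) (simp_all add: fchar_add)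

lemma fchar_measurable [measurable]: "fchar \<in> borel_measurable borel"
  unfolding fchar_def by (intro borel_measurable_continuous_onI continuous_intros)

text \<open>For a non-integrable \<open>f\<close> the left side is the default value 0; otherwise
  this is the triangle inequality.\<close>

lemma ennreal_norm_integral_le: "ennreal (norm (integral\<^sup>L M f)) \<le> (\<integral>\<^sup>+x. ennreal (norm (f x)) \<partial>M)"
  by (cases "integrable M f") (simp_all add: integral_norm_bound_ennreal not_integrable_integral_eq)

lemma fourier_L1_measurable [measurable]:
  assumes [measurable]: "f \<in> borel_measurable borel"
  shows "fourier_L1 f \<in> borel_measurable borel"
  unfolding fourier_L1_fchar[abs_def] by measurable

lemma norm_fourier_L1_le: "cmod (fourier_L1 f w) \<le> (LINT x|lborel. cmod (f x))"
  unfolding fourier_L1_fchar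
  using integral_norm_bound[of lborel "\<lambda>x. f x * fchar (x \<bullet> w)"] by (simp add: norm_mult)

lemma integrable_mult_fchar:
  assumes "integrable lborel f"
  shows "integrable lborel (\<lambda>x. f x * fchar (x \<bullet> w))"
proof (rule Bochner_Integration.integrable_bound[OF assms])
  note [measurable] = borel_measurable_integrable[OF assms]
  show "(\<lambda>x. f x * fchar (x \<bullet> w)) \<in> borel_measurable lborel" by measurable
qed (simp add: norm_mult)

lemma integrable_mult_bounded:
  fixes f g :: "'a::euclidean_space \<Rightarrow> complex"
  assumes f: "integrable lborel f" and [measurable]: "g \<in> borel_measurable borel"
    and le: "\<And>x. cmod (g x) \<le> C"
  shows "integrable lborel (\<lambda>x. f x * g x)"
proof (rule Bochner_Integration.integrable_bound)
  show "integrable lborel (\<lambda>x. C * cmod (f x))"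
    using f by simp
  note [measurable] = borel_measurable_integrable[OF f]
  show "(\<lambda>x. f x * g x) \<in> borel_measurable lborel" by measurable
  have "0 \<le> C"
    using le[of 0] norm_ge_zero[of "g 0"] by linarith
  then show "AE x in lborel. norm (f x * g x) \<le> norm (C * cmod (f x))"
    by (auto simp: norm_mult mult.commute[of C] intro!: mult_left_mono le)
qed

text \<open>Both sides are iterated integrals of f(x) g(w) \<open>fchar (x \<bullet> w)\<close>. The
  character has modulus 1, so the double integral converges absolutely and Fubini applies; the
  kernel is symmetric in x and w.\<close>

lemma fourier_L1_multiplication:
  assumes f: "integrable lborel f" and g: "integrable lborel g"
  shows "(LINT w|lborel. fourier_L1 f w * g w) = (LINT x|lborel. f x * fourier_L1 g x)"
proof -
  note [measurable] = borel_measurable_integrable[OF f] borel_measurable_integrable[OF g]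
  let ?h = "\<lambda>x w. f x * g w * fchar (x \<bullet> w)"
  have "integrable (lborel \<Otimes>\<^sub>M lborel) (case_prod ?h)"
  proof (rule lborel_pair.Fubini_integrable)
    show "case_prod ?h \<in> borel_measurable (lborel \<Otimes>\<^sub>M lborel)"
      by measurable
    show "integrable lborel (\<lambda>x. LINT w|lborel. norm (case_prod ?h (x, w)))"
      using f by (simp add: norm_mult)
    have "integrable lborel (\<lambda>w. f x * (g w * fchar (w \<bullet> x)))" for x
      by (intro integrable_mult_right integrable_mult_fchar g)
    then show "AE x in lborel. integrable lborel (\<lambda>w. case_prod ?h (x, w))"
      by (simp add: mult.assoc inner_commute)
  qed
  then have "(LINT w|lborel. LINT x|lborel. ?h x w) = (LINT x|lborel. LINT w|lborel. ?h x w)"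
    by (rule lborel_pair.Fubini_integral)
  moreover have "(LINT x|lborel. ?h x w) = fourier_L1 f w * g w" for w
  proof -
    have "(LINT x|lborel. ?h x w) = (LINT x|lborel. (f x * fchar (x \<bullet> w)) * g w)"
      by (simp add: mult_ac)
    then show ?thesis
      by (simp only: fourier_L1_fchar integral_mult_left_zero)
  qed
  moreover have "(LINT w|lborel. ?h x w) = f x * fourier_L1 g x" for x
  proof -
    have "(LINT w|lborel. ?h x w) = (LINT w|lborel. f x * (g w * fchar (w \<bullet> x)))"
      by (simp add: mult_ac inner_commute)
    then show ?thesis
      by (simp only: fourier_L1_fchar integral_mult_right_zero)
  qed
  ultimately show ?thesis
    by simp
qed

section \<open>Translations, reflections and products over coordinates\<close>

text \<open>The Jacobian is a power of |c|, hence 1. The case c = 1 gives translations and c = -1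
  the reflection; both are used.\<close>

lemma lborel_eq_distr_affine:
  assumes "\<bar>c\<bar> = (1::real)"
  shows "lborel = distr lborel borel (\<lambda>x::'a::euclidean_space. t + c *\<^sub>R x)"
  using lborel_affine[of c t] assms by (auto simp: density_1)

lemma nn_integral_lborel_affine:
  fixes f :: "'a::euclidean_space \<Rightarrow> ennreal"
  assumes [measurable]: "f \<in> borel_measurable borel" and c: "\<bar>c\<bar> = (1::real)"
  shows "(\<integral>\<^sup>+x. f (t + c *\<^sub>R x) \<partial>lborel) = (\<integral>\<^sup>+x. f x \<partial>lborel)"
  by (subst (2) lborel_eq_distr_affine[OF c, of t]) (simp add: nn_integral_distr)

lemma integral_lborel_affine:
  fixes f :: "'a::euclidean_space \<Rightarrow> 'b::{banach, second_countable_topology}"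
  assumes [measurable]: "f \<in> borel_measurable borel" and c: "\<bar>c\<bar> = (1::real)"
  shows "(LINT x|lborel. f (t + c *\<^sub>R x)) = (LINT x|lborel. f x)"
  by (subst (2) lborel_eq_distr_affine[OF c, of t]) (simp add: integral_distr)

lemma integrable_lborel_affine:
  fixes f :: "'a::euclidean_space \<Rightarrow> 'b::{banach, second_countable_topology}"
  assumes f: "integrable lborel f" and c: "\<bar>c\<bar> = (1::real)"
  shows "integrable lborel (\<lambda>x. f (t + c *\<^sub>R x))"
proof -
  have "integrable (distr lborel borel (\<lambda>x::'a. t + c *\<^sub>R x)) f"
    using f by (simp flip: lborel_eq_distr_affine[OF c])
  then show ?thesis
    by (rule integrable_distr[rotated]) measurable
qed

text \<open>\<open>lborel\<close> is the image of the product of one-dimensional Lebesgue measures,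
  so Fubini for finite products applies. This reduces Gaussian transforms to one dimension.\<close>

lemma integral_lborel_prod:
  fixes f :: "'a::euclidean_space \<Rightarrow> real \<Rightarrow> complex"
  assumes f: "\<And>b. b \<in> Basis \<Longrightarrow> integrable lborel (f b)"
  shows "(LINT x|(lborel :: 'a measure). (\<Prod>b\<in>Basis. f b (x \<bullet> b))) = (\<Prod>b\<in>Basis. (LINT s|lborel. f b s))"
proof -
  interpret product_sigma_finite "\<lambda>_::'a. lborel :: real measure"
    by unfold_locales
  have [measurable]: "f b \<in> borel_measurable borel" if "b \<in> Basis" for b
    using borel_measurable_integrable[OF f[OF that]] by simp
  have "(LINT x|(lborel :: 'a measure). (\<Prod>b\<in>Basis. f b (x \<bullet> b))) =
      (LINT x|(\<Pi>\<^sub>M b\<in>Basis. lborel). (\<Prod>b\<in>Basis. f b ((\<Sum>i\<in>Basis. x i *\<^sub>R i) \<bullet> b :: real)))"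
    by (subst lborel_eq) (rule integral_distr; measurable)
  also have "\<dots> = (LINT x|(\<Pi>\<^sub>M b\<in>Basis. lborel). (\<Prod>b\<in>Basis. f b (x b)))"
    by (intro Bochner_Integration.integral_cong prod.cong refl)
      (simp add: inner_sum_left_Basis)
  also have "\<dots> = (\<Prod>b\<in>Basis. (LINT s|lborel. f b s))"
    by (rule product_integral_prod) (auto intro: f)
  finally show ?thesis .
qed

section \<open>Gaussians and their transforms\<close>

text \<open>This is exp(-e^2 |w|^2 / 2), written as a product over the coordinates to suit the
  product formulas for integrals.\<close>

definition gauss :: "real \<Rightarrow> 'a::euclidean_space \<Rightarrow> real" where
  "gauss e w = (\<Prod>b\<in>Basis. exp (- (e * (w \<bullet> b))\<^sup>2 / 2))"

text \<open>For e > 0, the centred normal density with independent coordinates of standard deviation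
  e / (2 pi). It will be the transform of \<open>gauss e\<close>.\<close>

definition gauss_dual :: "real \<Rightarrow> 'a::euclidean_space \<Rightarrow> real" where
  "gauss_dual e z = (\<Prod>b\<in>Basis. 2 * pi / e * std_normal_density (2 * pi / e * (z \<bullet> b)))"

lemma exp_eq_std_normal_density: "exp (- t\<^sup>2 / 2) = sqrt (2 * pi) * std_normal_density t"
  by (simp add: std_normal_density_def)

lemma nn_integral_std_normal_density_scaled:
  assumes "0 < c"
  shows "(\<integral>\<^sup>+s. ennreal (c * std_normal_density (c * s)) \<partial>lborel) = 1"
proof -
  have "(\<integral>\<^sup>+s. ennreal (std_normal_density s) \<partial>lborel) = 1"
    by (subst nn_integral_eq_integral) auto
  then show ?thesis
    using assms nn_integral_real_affine[of "\<lambda>s. ennreal (std_normal_density s)" c 0]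
    by (simp add: ennreal_mult' nn_integral_cmult)
qed

lemma integrable_std_normal_density_scaled:
  assumes "0 < c"
  shows "integrable lborel (\<lambda>s. std_normal_density (c * s))"
  using lborel_integrable_real_affine[of std_normal_density c 0] assms by simp

text \<open>Read off from the characteristic function exp(-t^2 / 2) of the standard normal
  law.\<close>

lemma fourier_std_normal_density_scaled:
  assumes e: "0 < e"
  shows "(LINT s|lborel. complex_of_real (exp (- (e * s)\<^sup>2 / 2)) * fchar (s * z)) =
    complex_of_real (2 * pi / e * std_normal_density (2 * pi / e * z))"
proof -
  let ?n = std_normal_density
  \<comment> \<open>With this frequency the substitution x = e s turns \<open>iexp (?t * x)\<close>
    into \<open>fchar (s * z)\<close>.\<close>
  let ?t = "- (2 * pi * z / e)"
  have "complex_of_real (exp (- ?t\<^sup>2 / 2)) = (LINT x|lborel. ?n x *\<^sub>R iexp (?t * x))"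
    unfolding char_std_normal_distribution[symmetric, THEN fun_cong] char_def
    by (subst integral_density) auto
  also have "\<dots> = e *\<^sub>R (LINT s|lborel. ?n (e * s) *\<^sub>R iexp (?t * (e * s)))"
    using lborel_integral_real_affine[of e "\<lambda>x. ?n x *\<^sub>R iexp (?t * x)" 0] e by simp
  also have "\<dots> = e *\<^sub>R (LINT s|lborel. complex_of_real (?n (e * s)) * fchar (s * z))"
    using e by (intro arg_cong[where f="\<lambda>x. e *\<^sub>R x"] Bochner_Integration.integral_cong refl)
      (simp add: fchar_def scaleR_conv_of_real mult_ac)
  finally have eq: "(LINT s|lborel. complex_of_real (?n (e * s)) * fchar (s * z)) =
      complex_of_real (exp (- ?t\<^sup>2 / 2) / e)"
    using e by (simp add: scaleR_conv_of_real field_simps)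
  have "(LINT s|lborel. complex_of_real (exp (- (e * s)\<^sup>2 / 2)) * fchar (s * z)) =
      (LINT s|lborel. complex_of_real (sqrt (2 * pi)) * (complex_of_real (?n (e * s)) * fchar (s * z)))"
    unfolding exp_eq_std_normal_density by (simp add: mult_ac)
  also have "\<dots> = complex_of_real (sqrt (2 * pi)) * complex_of_real (exp (- ?t\<^sup>2 / 2) / e)"
    by (simp only: integral_mult_right_zero eq)
  also have "\<dots> = complex_of_real (2 * pi / e * ?n (2 * pi / e * z))"
  proof -
    have "exp (- ?t\<^sup>2 / 2) = sqrt (2 * pi) * ?n (2 * pi / e * z)"
      unfolding exp_eq_std_normal_density[symmetric] by (simp add: power_divide power_mult_distrib)
    \<comment> \<open>One factor sqrt(2 pi) comes from the Gaussian being transformed, the other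
      from rewriting its transform as a density; together they give the 2 pi in front.\<close>
    moreover have "sqrt (2 * pi) * (sqrt (2 * pi) * a) = 2 * pi * a" for a
      by (simp flip: mult.assoc)
    ultimately show ?thesis
      by (simp flip: of_real_mult)
  qed
  finally show ?thesis .
qed

lemma gauss_nonneg [simp]: "0 \<le> gauss e w"
  by (simp add: gauss_def prod_nonneg)

lemma gauss_dual_nonneg [simp]: "0 < e \<Longrightarrow> 0 \<le> gauss_dual e w"
  by (simp add: gauss_dual_def prod_nonneg)

lemma gauss_measurable [measurable]: "gauss e \<in> borel_measurable borel"
  unfolding gauss_def[abs_def] by measurable

lemma gauss_dual_measurable [measurable]: "gauss_dual e \<in> borel_measurable borel"
  unfolding gauss_dual_def[abs_def] by measurable

lemma integrable_gauss:
  assumes e: "0 < e"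
  shows "integrable lborel (gauss e :: 'a::euclidean_space \<Rightarrow> real)"
proof (rule integrableI_nonneg)
  have int: "integrable lborel (\<lambda>s. exp (- (e * s)\<^sup>2 / 2))"
    unfolding exp_eq_std_normal_density
    by (intro integrable_mult_right integrable_std_normal_density_scaled e)
  have "(\<integral>\<^sup>+w. ennreal (gauss e w) \<partial>(lborel :: 'a measure)) =
      (\<Prod>b\<in>(Basis :: 'a set). \<integral>\<^sup>+s. ennreal (exp (- (e * s)\<^sup>2 / 2)) \<partial>lborel)"
    unfolding gauss_def
    by (subst nn_integral_lborel_prod[symmetric]) (simp_all add: prod_ennreal)
  also have "\<dots> < \<infinity>"
    using int by (simp add: nn_integral_eq_integral ennreal_power)
  finally show "(\<integral>\<^sup>+w. ennreal (gauss e w) \<partial>(lborel :: 'a measure)) < \<infinity>" .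
qed simp_all

lemma nn_integral_gauss_dual:
  assumes e: "0 < e"
  shows "(\<integral>\<^sup>+z. ennreal (gauss_dual e z) \<partial>(lborel :: 'a::euclidean_space measure)) = 1"
proof -
  have "(\<integral>\<^sup>+z. ennreal (gauss_dual e z) \<partial>(lborel :: 'a measure)) =
      (\<Prod>b\<in>(Basis :: 'a set). \<integral>\<^sup>+s. ennreal (2 * pi / e * std_normal_density (2 * pi / e * s)) \<partial>lborel)"
    unfolding gauss_dual_def using e
    by (subst nn_integral_lborel_prod[symmetric]) (simp_all add: prod_ennreal)
  also have "\<dots> = 1"
    using e by (subst nn_integral_std_normal_density_scaled) simp_all
  finally show ?thesis .
qed

text \<open>The character factors over the coordinates just as the Gaussian does, so the integral
  splits into one-dimensional transforms.\<close>

lemma fourier_L1_gauss: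
  assumes e: "0 < e"
  shows "fourier_L1 (\<lambda>w. complex_of_real (gauss e w)) z = complex_of_real (gauss_dual e z)"
proof -
  let ?f = "\<lambda>b s. complex_of_real (exp (- (e * s)\<^sup>2 / 2)) * fchar (s * (z \<bullet> b))"
  have int: "integrable lborel (?f b)" for b
  proof (rule integrable_mult_bounded)
    show "integrable lborel (\<lambda>s. complex_of_real (exp (- (e * s)\<^sup>2 / 2)))"
      unfolding exp_eq_std_normal_density
      by (intro integrable_of_real integrable_mult_right integrable_std_normal_density_scaled e)
    show "(\<lambda>s. fchar (s * (z \<bullet> b))) \<in> borel_measurable borel" by measurable
  qed (rule norm_fchar[THEN eq_refl])
  have "complex_of_real (gauss e w) * fchar (w \<bullet> z) = (\<Prod>b\<in>Basis. ?f b (w \<bullet> b))" for w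
    unfolding gauss_def of_real_prod prod.distrib
    by (subst euclidean_inner) (simp add: fchar_sum)
  then have "fourier_L1 (\<lambda>w. complex_of_real (gauss e w)) z =
      (LINT w|lborel. (\<Prod>b\<in>Basis. ?f b (w \<bullet> b)))"
    by (simp add: fourier_L1_fchar)
  also have "\<dots> = (\<Prod>b\<in>Basis. (LINT s|lborel. ?f b s))"
    by (rule integral_lborel_prod) (rule int)
  also have "\<dots> = complex_of_real (gauss_dual e z)"
    unfolding gauss_dual_def of_real_prod
    by (intro prod.cong refl fourier_std_normal_density_scaled e)
  finally show ?thesis .
qed

section \<open>Plancherel's inequality on L^1\<close>

text \<open>Conjugation inverts the character and the reflection x -> -x inverts it back. Thus the
  squared modulus of a transform becomes a product of two transforms.\<close>

lemma cnj_fourier_L1: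
  assumes [measurable]: "f \<in> borel_measurable borel"
  shows "cnj (fourier_L1 f w) = fourier_L1 (\<lambda>x. cnj (f (- x))) w"
proof -
  have [measurable]: "(\<lambda>x. cnj (f x)) \<in> borel_measurable borel"
    by (rule measurable_compose[OF assms
          borel_measurable_continuous_onI[OF continuous_on_cnj[OF continuous_on_id]]])
  have "cnj (fourier_L1 f w) = (LINT x|lborel. cnj (f x) * fchar (- x \<bullet> w))"
    unfolding fourier_L1_fchar
    by (subst Bochner_Integration.integral_cnj[symmetric]) (simp add: cnj_fchar del: Bochner_Integration.integral_cnj)
  also have "\<dots> = (LINT x|lborel. cnj (f (- x)) * fchar (x \<bullet> w))"
    using integral_lborel_affine[of "\<lambda>x. cnj (f x) * fchar (- x \<bullet> w)" "-1" 0] by simp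
  finally show ?thesis
    by (simp add: fourier_L1_fchar)
qed

lemma fourier_L1_modulate: "fourier_L1 (\<lambda>x. f x * fchar (x \<bullet> a)) w = fourier_L1 f (a + w)"
  by (simp add: fourier_L1_fchar inner_add_right fchar_add mult.assoc)

text \<open>
  The Gaussian weight makes all integrals converge absolutely, so that two applications of the
  multiplication formula move both transforms onto the weight. The resulting kernel has total
  mass one.
\<close>

lemma nn_integral_gauss_fourier_L1_le:
  fixes u :: "'a::euclidean_space \<Rightarrow> complex"
  assumes u: "integrable lborel u" and e: "0 < e"
  shows "(\<integral>\<^sup>+w. ennreal (gauss e w * (cmod (fourier_L1 u w))\<^sup>2) \<partial>lborel) \<le> nnsq u"
proof -
  note [measurable] = borel_measurable_integrable[OF u]
  \<comment> \<open>The transform of \<open>v\<close> is the conjugate of that of \<open>u\<close>,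
    so the weighted integral equals that of \<open>fourier_L1 u w * p w\<close>. The first use of
    the multiplication formula trades this for \<open>u x * fourier_L1 p x\<close>; the second,
    inside \<open>p_hat\<close>, transfers the transform from \<open>v\<close> to the modulated
    Gaussian.\<close>
  define v where "v y = cnj (u (- y))" for y
  define p where "p w = complex_of_real (gauss e w) * cnj (fourier_L1 u w)" for w
  have v: "integrable lborel v"
    unfolding v_def using integrable_lborel_affine[OF u, of "-1" 0] by simp
  note [measurable] = borel_measurable_integrable[OF v]
  have v_hat: "fourier_L1 v w = cnj (fourier_L1 u w)" for w
    using cnj_fourier_L1[of u w] by (simp add: v_def[abs_def])
  have gauss_c: "integrable lborel (\<lambda>w::'a. complex_of_real (gauss e w))"
    by (intro integrable_of_real integrable_gauss e)
  have p: "integrable lborel p"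
    unfolding p_def v_hat[symmetric]
    by (rule integrable_mult_bounded[OF gauss_c _ norm_fourier_L1_le]) measurable
  have p_hat: "fourier_L1 p x = (LINT y|lborel. v y * complex_of_real (gauss_dual e (x + y)))" for x
  proof -
    let ?q = "\<lambda>w. complex_of_real (gauss e w) * fchar (w \<bullet> x)"
    have "fourier_L1 p x = (LINT w|lborel. fourier_L1 v w * ?q w)"
      by (simp add: fourier_L1_fchar[of p] p_def v_hat mult_ac)
    also have "\<dots> = (LINT y|lborel. v y * fourier_L1 ?q y)"
      by (intro fourier_L1_multiplication v integrable_mult_fchar gauss_c)
    also have "\<dots> = (LINT y|lborel. v y * complex_of_real (gauss_dual e (x + y)))"
      by (simp only: fourier_L1_modulate fourier_L1_gauss[OF e])
    finally show ?thesis .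
  qed
  have nnsq_v: "nnsq v = nnsq u"
    unfolding nnsq_def v_def
    using nn_integral_lborel_affine[of "\<lambda>x. ennreal ((cmod (u x))\<^sup>2)" "-1" 0] by simp
  \<comment> \<open>The coefficient in a b <= (a^2 + b^2) / 2.\<close>
  define h :: real where "h = 1 / 2"
  then have h: "0 \<le> h" "h + h = 1"
    by simp_all
  let ?G = "\<lambda>x y. ennreal (gauss_dual e (x + y))"
  have mass: "(\<integral>\<^sup>+y. ?G x y \<partial>lborel) = 1" for x :: 'a
    using nn_integral_lborel_affine[of "\<lambda>z. ennreal (gauss_dual e z)" 1 x]
    by (simp add: nn_integral_gauss_dual[OF e])
  have "(\<integral>\<^sup>+w. ennreal (gauss e w * (cmod (fourier_L1 u w))\<^sup>2) \<partial>lborel) =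
      ennreal (LINT w|lborel. gauss e w * (cmod (fourier_L1 u w))\<^sup>2)"
  proof (rule nn_integral_eq_integral)
    have "integrable lborel (\<lambda>w. fourier_L1 u w * p w)"
      using integrable_mult_bounded[OF p _ norm_fourier_L1_le, of u] by (simp add: mult.commute)
    then have "integrable lborel (\<lambda>w. cmod (fourier_L1 u w * p w))"
      by (rule integrable_norm)
    then show "integrable lborel (\<lambda>w. gauss e w * (cmod (fourier_L1 u w))\<^sup>2)"
      by (simp add: p_def norm_mult power2_eq_square mult_ac)
  qed simp
  also have "(LINT w|lborel. gauss e w * (cmod (fourier_L1 u w))\<^sup>2) =
      cmod (LINT w|lborel. fourier_L1 u w * p w)"
  proof -
    have "fourier_L1 u w * p w = complex_of_real (gauss e w * (cmod (fourier_L1 u w))\<^sup>2)" for w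
      by (simp add: p_def mult.left_commute flip: complex_norm_square)
    then have "(LINT w|lborel. fourier_L1 u w * p w) =
        complex_of_real (LINT w|lborel. gauss e w * (cmod (fourier_L1 u w))\<^sup>2)"
      by (simp only: integral_complex_of_real)
    then show ?thesis
      by (simp add: integral_nonneg_AE)
  qed
  also have "(LINT w|lborel. fourier_L1 u w * p w) = (LINT x|lborel. u x * fourier_L1 p x)"
    by (rule fourier_L1_multiplication[OF u p])
  also have "ennreal (cmod \<dots>) \<le> (\<integral>\<^sup>+x. ennreal (cmod (u x * fourier_L1 p x)) \<partial>lborel)"
    by (rule ennreal_norm_integral_le)
  \<comment> \<open>Schur's test: splitting |u(x)| |v(y)| by the arithmetic-geometric mean leaves in
    each term a kernel whose integral over the variable absent from the square is 1.\<close>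
  also have "\<dots> \<le> (\<integral>\<^sup>+x. (\<integral>\<^sup>+y. ennreal h * (ennreal ((cmod (u x))\<^sup>2) * ?G x y) +
      ennreal h * (ennreal ((cmod (v y))\<^sup>2) * ?G y x) \<partial>lborel) \<partial>lborel)"
  proof (rule nn_integral_mono)
    fix x
    have "ennreal (cmod (u x * fourier_L1 p x)) =
        ennreal (cmod (u x)) * ennreal (cmod (LINT y|lborel. v y * complex_of_real (gauss_dual e (x + y))))"
      by (simp add: norm_mult ennreal_mult p_hat)
    also have "\<dots> \<le> ennreal (cmod (u x)) *
        (\<integral>\<^sup>+y. ennreal (cmod (v y * complex_of_real (gauss_dual e (x + y)))) \<partial>lborel)"
      by (intro mult_left_mono ennreal_norm_integral_le) simp
    also have "\<dots> = (\<integral>\<^sup>+y. ennreal (cmod (u x)) *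
        ennreal (cmod (v y * complex_of_real (gauss_dual e (x + y)))) \<partial>lborel)"
      by (rule nn_integral_cmult[symmetric]) measurable
    also have "\<dots> \<le> (\<integral>\<^sup>+y. ennreal h * (ennreal ((cmod (u x))\<^sup>2) * ?G x y) +
      ennreal h * (ennreal ((cmod (v y))\<^sup>2) * ?G y x) \<partial>lborel)"
    proof (rule nn_integral_mono)
      fix y
      let ?a = "cmod (u x)" and ?b = "cmod (v y)" and ?g = "gauss_dual e (x + y)"
      have "?a * (?b * ?g) \<le> h * (?a\<^sup>2 * ?g) + h * (?b\<^sup>2 * ?g)"
        using mult_right_mono[OF sum_squares_bound[of ?a ?b] gauss_dual_nonneg[OF e, of "x + y"]]
        by (simp add: h_def algebra_simps)
      then have "ennreal (?a * (?b * ?g)) \<le> ennreal (h * (?a\<^sup>2 * ?g) + h * (?b\<^sup>2 * ?g))"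
        by (rule ennreal_leI)
      then show "ennreal ?a * ennreal (cmod (v y * complex_of_real ?g)) \<le>
          ennreal h * (ennreal (?a\<^sup>2) * ?G x y) + ennreal h * (ennreal (?b\<^sup>2) * ?G y x)"
        using gauss_dual_nonneg[OF e, of "x + y"] h
        by (simp add: norm_mult ennreal_mult ennreal_plus add.commute[of y x] del: gauss_dual_nonneg)
    qed
    finally show "ennreal (cmod (u x * fourier_L1 p x)) \<le> \<dots>" .
  qed
  also have "\<dots> = (\<integral>\<^sup>+x. \<integral>\<^sup>+y. ennreal h * (ennreal ((cmod (u x))\<^sup>2) * ?G x y) \<partial>lborel \<partial>lborel) +
      (\<integral>\<^sup>+x. \<integral>\<^sup>+y. ennreal h * (ennreal ((cmod (v y))\<^sup>2) * ?G y x) \<partial>lborel \<partial>lborel)"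
    by (simp add: nn_integral_add)
  \<comment> \<open>Tonelli: the square of \<open>v y\<close> does not involve x, so the x-integral
    must become the inner one for the unit mass to apply.\<close>
  also have "(\<integral>\<^sup>+x. \<integral>\<^sup>+y. ennreal h * (ennreal ((cmod (v y))\<^sup>2) * ?G y x) \<partial>lborel \<partial>lborel) =
      (\<integral>\<^sup>+y. \<integral>\<^sup>+x. ennreal h * (ennreal ((cmod (v y))\<^sup>2) * ?G y x) \<partial>lborel \<partial>lborel)"
    by (rule lborel_pair.Fubini') measurable
  also have "(\<integral>\<^sup>+x. \<integral>\<^sup>+y. ennreal h * (ennreal ((cmod (u x))\<^sup>2) * ?G x y) \<partial>lborel \<partial>lborel) =
      ennreal h * nnsq u"
    unfolding nnsq_def by (simp add: nn_integral_cmult mass)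
  also have "(\<integral>\<^sup>+y. \<integral>\<^sup>+x. ennreal h * (ennreal ((cmod (v y))\<^sup>2) * ?G y x) \<partial>lborel \<partial>lborel) =
      ennreal h * nnsq v"
    unfolding nnsq_def by (simp add: nn_integral_cmult mass)
  also have "ennreal h * nnsq u + ennreal h * nnsq v = nnsq u"
  proof -
    have "ennreal h + ennreal h = 1"
      by (simp add: h flip: ennreal_plus)
    then show ?thesis
      by (simp add: nnsq_v flip: distrib_right)
  qed
  finally show ?thesis .
qed

text \<open>The bound for the weighted integral does not depend on e. As e = 1/(n+1) tends to 0 the
  weight tends to 1 pointwise, and Fatou removes it. If \<open>u\<close> is not square integrable,
  the right side is infinite.\<close>

lemma nnsq_fourier_L1_le:
  fixes u :: "'a::euclidean_space \<Rightarrow> complex"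
  assumes u: "integrable lborel u"
  shows "nnsq (fourier_L1 u) \<le> nnsq u"
proof -
  note [measurable] = borel_measurable_integrable[OF u]
  let ?e = "\<lambda>n. inverse (real (Suc n))"
  have lim: "(\<lambda>n. gauss (?e n) w) \<longlonglongrightarrow> 1" for w :: 'a
  proof -
    have "(\<lambda>n. gauss (?e n) w) \<longlonglongrightarrow> (\<Prod>b\<in>(Basis :: 'a set). exp (- (0 * (w \<bullet> b))\<^sup>2 / 2))"
      unfolding gauss_def by (intro tendsto_intros LIMSEQ_inverse_real_of_nat) simp
    then show ?thesis
      by simp
  qed
  have "nnsq (fourier_L1 u) =
      (\<integral>\<^sup>+w. liminf (\<lambda>n. ennreal (gauss (?e n) w * (cmod (fourier_L1 u w))\<^sup>2)) \<partial>lborel)"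
    unfolding nnsq_def
  proof (intro nn_integral_cong lim_imp_Liminf[symmetric] tendsto_ennrealI)
    fix w :: 'a
    show "(\<lambda>n. gauss (?e n) w * (cmod (fourier_L1 u w))\<^sup>2) \<longlonglongrightarrow> (cmod (fourier_L1 u w))\<^sup>2"
      using tendsto_mult[OF lim tendsto_const, of w "(cmod (fourier_L1 u w))\<^sup>2"] by simp
  qed simp
  also have "\<dots> \<le> liminf (\<lambda>n. \<integral>\<^sup>+w. ennreal (gauss (?e n) w * (cmod (fourier_L1 u w))\<^sup>2) \<partial>lborel)"
    by (rule nn_integral_liminf) measurable
  also have "\<dots> \<le> limsup (\<lambda>n. \<integral>\<^sup>+w. ennreal (gauss (?e n) w * (cmod (fourier_L1 u w))\<^sup>2) \<partial>lborel)"
    by (rule Liminf_le_Limsup) simp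
  also have "\<dots> \<le> nnsq u"
    by (intro Limsup_bounded always_eventually allI nn_integral_gauss_fourier_L1_le u) simp
  finally show ?thesis .
qed

lemma fourier_L1_diff:
  assumes "integrable lborel f" "integrable lborel g"
  shows "fourier_L1 (\<lambda>x. f x - g x) w = fourier_L1 f w - fourier_L1 g w"
  unfolding fourier_L1_fchar left_diff_distrib
  by (intro Bochner_Integration.integral_diff integrable_mult_fchar assms)

lemma fourier_L1_L2:
  assumes "u \<in> L2" "integrable lborel u"
  shows "fourier_L1 u \<in> L2"
  using assms le_less_trans[OF nnsq_fourier_L1_le[OF assms(2)], of \<infinity>]
  by (simp add: L2_iff_nnsq fourier_L1_measurable)

section \<open>The Fourier transform on L^2\<close>

lemma L2_norm_mono:
  assumes "f \<in> L2" "g \<in> L2" "nnsq f \<le> nnsq g"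
  shows "L2_norm f \<le> L2_norm g"
proof (rule power2_le_imp_le)
  show "(L2_norm f)\<^sup>2 \<le> (L2_norm g)\<^sup>2"
    using assms by (simp add: nnsq_eq_L2_norm)
qed simp

lemma L2_norm_sq_eq_pairing: "complex_of_real ((L2_norm f)\<^sup>2) = (LINT x|lborel. f x * cnj (f x))"
proof -
  have "(L2_norm f)\<^sup>2 = (LINT x|lborel. (cmod (f x))\<^sup>2)"
    by (simp add: L2_norm_def)
  then show ?thesis
    by (simp only: complex_norm_square[symmetric] integral_complex_of_real)
qed

text \<open>The squared norm is the pairing of a function with its conjugate, so continuity of the
  pairing takes the place of a triangle inequality for \<open>L2_norm\<close>.\<close>

lemma tendsto_L2_norm:
  assumes L2: "\<And>n. f n \<in> L2" "F \<in> L2" and f: "(\<lambda>n. L2_norm (\<lambda>x. f n x - F x)) \<longlonglongrightarrow> 0"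
  shows "(\<lambda>n. L2_norm (f n)) \<longlonglongrightarrow> L2_norm F"
proof -
  have "L2_norm (\<lambda>x. cnj (f n x) - cnj (F x)) = L2_norm (\<lambda>x. f n x - F x)" for n
    by (simp add: L2_norm_def flip: complex_cnj_diff)
  then have "(\<lambda>n. LINT x|lborel. f n x * cnj (f n x)) \<longlonglongrightarrow> (LINT x|lborel. F x * cnj (F x))"
    by (intro tendsto_L2_pairing L2 L2_cnj f) (simp add: f)
  then have "(\<lambda>n. complex_of_real ((L2_norm (f n))\<^sup>2)) \<longlonglongrightarrow> complex_of_real ((L2_norm F)\<^sup>2)"
    by (simp only: L2_norm_sq_eq_pairing)
  then have "(\<lambda>n. (L2_norm (f n))\<^sup>2) \<longlonglongrightarrow> (L2_norm F)\<^sup>2"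
    by (simp only: tendsto_of_real_iff)
  then have "(\<lambda>n. sqrt ((L2_norm (f n))\<^sup>2)) \<longlonglongrightarrow> sqrt ((L2_norm F)\<^sup>2)"
    by (rule tendsto_real_sqrt)
  then show ?thesis
    by simp
qed

text \<open>Multiplied by this indicator, an L^2 function becomes a product of two L^2 functions and
  hence integrable.\<close>

lemma indicator_ball_L2: "(indicator (ball 0 r) :: 'a::euclidean_space \<Rightarrow> complex) \<in> L2"
proof -
  have "nnsq (indicator (ball 0 r) :: 'a \<Rightarrow> complex) =
      (\<integral>\<^sup>+x. indicator (ball 0 r) x \<partial>(lborel :: 'a measure))"
    unfolding nnsq_def by (intro nn_integral_cong) (auto simp: indicator_def)
  also have "\<dots> < \<infinity>"
    using emeasure_lborel_ball_finite[of "0 :: 'a" r] by simp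
  finally show ?thesis
    by (simp add: L2_iff_nnsq borel_measurable_indicator)
qed

text \<open>The truncations of \<open>f\<close> to balls lie in both L^1 and L^2 and tend to
  \<open>f\<close> by dominated convergence. Plancherel's inequality, applied to their differences,
  makes their transforms Cauchy, and completeness supplies the limit.\<close>

lemma is_fourier_L2_exists:
  assumes f: "f \<in> L2"
  shows "\<exists>g. is_fourier_L2 f g"
proof -
  note [measurable] = L2_measurable[OF f]
  define u where "u n x = indicator (ball 0 (real n)) x * f x" for n x
  have u_L2: "u n \<in> L2" for n
    unfolding u_def[abs_def]
    by (rule L2_bounded_mult[OF f]) (auto simp: indicator_def)
  have u_int: "integrable lborel (u n)" for n
    unfolding u_def[abs_def] by (intro L2_mult_integrable indicator_ball_L2 f)
  note [measurable] = L2_measurable[OF u_L2]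
  have u_lim: "(\<lambda>n. nnsq (\<lambda>x. u n x - f x)) \<longlonglongrightarrow> 0"
  proof -
    have "(\<lambda>n. \<integral>\<^sup>+x. ennreal ((cmod (u n x - f x))\<^sup>2) \<partial>lborel) \<longlonglongrightarrow> (\<integral>\<^sup>+x. 0 \<partial>(lborel :: 'a measure))"
    proof (rule nn_integral_dominated_convergence[where w="\<lambda>x. ennreal ((cmod (f x))\<^sup>2)"])
      show "(\<integral>\<^sup>+x. ennreal ((cmod (f x))\<^sup>2) \<partial>lborel) < \<infinity>"
        using f by (simp add: L2_iff_nnsq nnsq_def)
      show "AE x in lborel. ennreal ((cmod (u n x - f x))\<^sup>2) \<le> ennreal ((cmod (f x))\<^sup>2)" for n
        by (auto simp: u_def indicator_def)
      show "AE x in lborel. (\<lambda>n. ennreal ((cmod (u n x - f x))\<^sup>2)) \<longlonglongrightarrow> 0"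
      proof (rule AE_I2)
        fix x :: 'a
        obtain N :: nat where "norm x < real N"
          using reals_Archimedean2 by blast
        then have "\<forall>\<^sub>F n in sequentially. ennreal ((cmod (u n x - f x))\<^sup>2) = 0"
          by (intro eventually_sequentiallyI[of N]) (simp add: u_def)
        then show "(\<lambda>n. ennreal ((cmod (u n x - f x))\<^sup>2)) \<longlonglongrightarrow> 0"
          by (rule tendsto_eventually)
      qed
    qed measurable
    then show ?thesis
      by (simp add: nnsq_def)
  qed
  have "\<exists>N. \<forall>m\<ge>N. \<forall>n\<ge>N. nnsq (\<lambda>x. fourier_L1 (u m) x - fourier_L1 (u n) x) \<le> ennreal e"
    if e: "0 < e" for e
  proof -
    \<comment> \<open>Two distances to \<open>f\<close>, each doubled by
      \<open>nnsq_diff_le\<close>, have to add up to e.\<close>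
    have "\<forall>\<^sub>F n in sequentially. nnsq (\<lambda>x. u n x - f x) < ennreal (e/4)"
      by (rule order_tendstoD[OF u_lim]) (use e in simp)
    then obtain N where N: "\<And>n. N \<le> n \<Longrightarrow> nnsq (\<lambda>x. u n x - f x) < ennreal (e/4)"
      unfolding eventually_sequentially by blast
    have "nnsq (\<lambda>x. fourier_L1 (u m) x - fourier_L1 (u n) x) \<le> ennreal e"
      if "N \<le> m" "N \<le> n" for m n
    proof -
      have "nnsq (\<lambda>x. fourier_L1 (u m) x - fourier_L1 (u n) x) = nnsq (fourier_L1 (\<lambda>x. u m x - u n x))"
        by (simp add: nnsq_def fourier_L1_diff u_int)
      also have "\<dots> \<le> nnsq (\<lambda>x. u m x - u n x)"
        by (intro nnsq_fourier_L1_le Bochner_Integration.integrable_diff u_int)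
      also have "\<dots> = nnsq (\<lambda>x. (u m x - f x) - (u n x - f x))"
        by simp
      also have "\<dots> \<le> 2 * nnsq (\<lambda>x. u m x - f x) + 2 * nnsq (\<lambda>x. u n x - f x)"
        by (rule nnsq_diff_le) measurable
      also have "\<dots> \<le> 2 * ennreal (e/4) + 2 * ennreal (e/4)"
        by (intro add_mono mult_left_mono less_imp_le N that) simp_all
      also have "\<dots> = ennreal e"
      proof -
        have "2 * ennreal (e/4) = ennreal (e/2)"
          using e ennreal_mult[of 2 "e/4"] by simp
        then show ?thesis
          using e by (simp flip: ennreal_plus)
      qed
      finally show ?thesis .
    qed
    then show ?thesis
      by blast
  qed
  then obtain g where "g \<in> L2" "(\<lambda>n. L2_norm (\<lambda>x. fourier_L1 (u n) x - g x)) \<longlonglongrightarrow> 0"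
    using L2_complete[of "\<lambda>n. fourier_L1 (u n)"] fourier_L1_L2[OF u_L2 u_int] by blast
  moreover have "(\<lambda>n. L2_norm (\<lambda>x. u n x - f x)) \<longlonglongrightarrow> 0"
    using u_lim by (simp add: tendsto_L2_norm_zero_iff L2_diff u_L2 f)
  ultimately show ?thesis
    unfolding is_fourier_L2_def using f u_L2 u_int fourier_L1_L2[OF u_L2 u_int] by blast
qed

lemma is_fourier_L2_fourier_L2: "f \<in> L2 \<Longrightarrow> is_fourier_L2 f (fourier_L2 f)"
  unfolding fourier_L2_def by (rule someI_ex[OF is_fourier_L2_exists])

lemma is_fourier_L2_norm_le:
  assumes "is_fourier_L2 f g"
  shows "L2_norm g \<le> L2_norm f"
proof -
  obtain u where u: "\<And>n. u n \<in> L2" "\<And>n. integrable lborel (u n)" "\<And>n. fourier_L1 (u n) \<in> L2"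
    and lim: "(\<lambda>n. L2_norm (\<lambda>x. u n x - f x)) \<longlonglongrightarrow> 0"
      "(\<lambda>n. L2_norm (\<lambda>w. fourier_L1 (u n) w - g w)) \<longlonglongrightarrow> 0"
    and fg: "f \<in> L2" "g \<in> L2"
    using assms unfolding is_fourier_L2_def by blast
  show ?thesis
  proof (rule LIMSEQ_le)
    show "(\<lambda>n. L2_norm (fourier_L1 (u n))) \<longlonglongrightarrow> L2_norm g"
      by (rule tendsto_L2_norm[OF u(3) fg(2) lim(2)])
    show "(\<lambda>n. L2_norm (u n)) \<longlonglongrightarrow> L2_norm f"
      by (rule tendsto_L2_norm[OF u(1) fg(1) lim(1)])
    show "\<exists>N. \<forall>n\<ge>N. L2_norm (fourier_L1 (u n)) \<le> L2_norm (u n)"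
      by (intro exI allI impI L2_norm_mono u nnsq_fourier_L1_le)
  qed
qed

text \<open>The approximants of \<open>f\<close> and \<open>g\<close> are run along the same index,
  so the identity for integrable functions passes to the limit in both arguments at once.\<close>

lemma is_fourier_L2_multiplication:
  assumes f: "is_fourier_L2 f f'" and g: "is_fourier_L2 g g'"
  shows "(LINT x|lborel. f' x * g x) = (LINT x|lborel. f x * g' x)"
proof -
  obtain u where u: "\<And>n. u n \<in> L2" "\<And>n. integrable lborel (u n)" "\<And>n. fourier_L1 (u n) \<in> L2"
    and u_lim: "(\<lambda>n. L2_norm (\<lambda>x. u n x - f x)) \<longlonglongrightarrow> 0"
      "(\<lambda>n. L2_norm (\<lambda>w. fourier_L1 (u n) w - f' w)) \<longlonglongrightarrow> 0"
    and f_L2: "f \<in> L2" "f' \<in> L2"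
    using f unfolding is_fourier_L2_def by blast
  obtain v where v: "\<And>n. v n \<in> L2" "\<And>n. integrable lborel (v n)" "\<And>n. fourier_L1 (v n) \<in> L2"
    and v_lim: "(\<lambda>n. L2_norm (\<lambda>x. v n x - g x)) \<longlonglongrightarrow> 0"
      "(\<lambda>n. L2_norm (\<lambda>w. fourier_L1 (v n) w - g' w)) \<longlonglongrightarrow> 0"
    and g_L2: "g \<in> L2" "g' \<in> L2"
    using g unfolding is_fourier_L2_def by blast
  have "(\<lambda>n. LINT x|lborel. fourier_L1 (u n) x * v n x) \<longlonglongrightarrow> (LINT x|lborel. f' x * g x)"
    by (rule tendsto_L2_pairing[OF u(3) v(1) f_L2(2) g_L2(1) u_lim(2) v_lim(1)])
  moreover have "(\<lambda>n. LINT x|lborel. u n x * fourier_L1 (v n) x) \<longlonglongrightarrow> (LINT x|lborel. f x * g' x)"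
    by (rule tendsto_L2_pairing[OF u(1) v(3) f_L2(1) g_L2(2) u_lim(1) v_lim(2)])
  ultimately show ?thesis
    unfolding fourier_L1_multiplication[OF u(2) v(2)] by (rule LIMSEQ_unique)
qed

section \<open>Translations and the representing function\<close>

lemma L2_norm_translate:
  assumes [measurable]: "f \<in> borel_measurable borel"
  shows "L2_norm (\<lambda>x. f (x - a)) = L2_norm f"
  unfolding L2_norm_def
  using integral_lborel_affine[of "\<lambda>x. (cmod (f x))\<^sup>2" 1 "- a"] by simp

lemma L2_translate:
  assumes f: "f \<in> L2"
  shows "translate a f \<in> L2"
proof -
  note [measurable] = L2_measurable[OF f]
  have "nnsq (translate a f) = nnsq f"
    unfolding nnsq_def translate_def
    using nn_integral_lborel_affine[of "\<lambda>x. ennreal ((cmod (f x))\<^sup>2)" 1 "- a"] by simp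
  moreover have "translate a f \<in> borel_measurable borel"
    unfolding translate_def by measurable
  ultimately show ?thesis
    using f by (simp add: L2_iff_nnsq)
qed

lemma fourier_L1_translate:
  assumes [measurable]: "f \<in> borel_measurable borel"
  shows "fourier_L1 (translate a f) w = fchar (a \<bullet> w) * fourier_L1 f w"
proof -
  have "fourier_L1 (translate a f) w = (LINT x|lborel. f x * fchar ((x + a) \<bullet> w))"
    unfolding fourier_L1_fchar translate_def
    using integral_lborel_affine[of "\<lambda>x. f x * fchar ((x + a) \<bullet> w)" 1 "- a"] by simp
  also have "\<dots> = (LINT x|lborel. fchar (a \<bullet> w) * (f x * fchar (x \<bullet> w)))"
    by (simp add: inner_add_left fchar_add mult_ac)
  finally show ?thesis
    by (simp only: integral_mult_right_zero fourier_L1_fchar)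
qed

lemma L2_norm_fchar_mult: "L2_norm (\<lambda>w. fchar (t w) * f w) = L2_norm f"
  by (simp add: L2_norm_def norm_mult)

lemma L2_fchar_mult:
  assumes "f \<in> L2"
  shows "(\<lambda>w. fchar (a \<bullet> w) * f w) \<in> L2"
  by (rule L2_bounded_mult[OF assms]) auto

text \<open>Translating an approximating sequence gives one for the translate: translation preserves
  distances on the one side, multiplication by a unimodular character on the other.\<close>

lemma is_fourier_L2_translate:
  assumes "is_fourier_L2 f g"
  shows "is_fourier_L2 (translate a f) (\<lambda>w. fchar (a \<bullet> w) * g w)"
proof -
  obtain u where u: "\<And>n. u n \<in> L2" "\<And>n. integrable lborel (u n)" "\<And>n. fourier_L1 (u n) \<in> L2"
    and lim: "(\<lambda>n. L2_norm (\<lambda>x. u n x - f x)) \<longlonglongrightarrow> 0"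
      "(\<lambda>n. L2_norm (\<lambda>w. fourier_L1 (u n) w - g w)) \<longlonglongrightarrow> 0"
    and fg: "f \<in> L2" "g \<in> L2"
    using assms unfolding is_fourier_L2_def by blast
  have u': "fourier_L1 (translate a (u n)) = (\<lambda>w. fchar (a \<bullet> w) * fourier_L1 (u n) w)" for n
    by (intro ext fourier_L1_translate L2_measurable u)
  have "integrable lborel (translate a (u n))" for n
    unfolding translate_def using integrable_lborel_affine[OF u(2)[of n], of 1 "- a"] by simp
  moreover have "L2_norm (\<lambda>x. translate a (u n) x - translate a f x) = L2_norm (\<lambda>x. u n x - f x)" for n
    unfolding translate_def by (intro L2_norm_translate L2_measurable L2_diff u fg)
  moreover have "L2_norm (\<lambda>w. fourier_L1 (translate a (u n)) w - fchar (a \<bullet> w) * g w) =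
      L2_norm (\<lambda>w. fourier_L1 (u n) w - g w)" for n
    by (simp only: u' right_diff_distrib[symmetric] L2_norm_fchar_mult)
  ultimately show ?thesis
    unfolding is_fourier_L2_def
    using lim by (intro conjI exI[of _ "\<lambda>n. translate a (u n)"])
      (auto simp: u' intro: L2_translate L2_fchar_mult u fg)
qed

text \<open>
  The functional that the Fourier side induces on the translates is represented by \<open>f\<close>,
  the conjugate of the transform of the conjugate: only the contraction property of the transform
  enters, not its surjectivity.
\<close>

lemma fourier_L1_norm_square_representation:
  fixes \<phi> :: "'a::euclidean_space \<Rightarrow> complex"
  assumes \<phi>: "is_fourier_L2 \<phi> g"
  obtains f where "f \<in> L2" "L2_norm f \<le> L2_norm \<phi>"
    "\<And>b. L2_inner f (translate b \<phi>) =
      fourier_L1 (\<lambda>w. complex_of_real ((cmod (g w))\<^sup>2)) (a - b)"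
proof -
  \<comment> \<open>A transform of \<open>translate a \<phi>\<close>; the function
    \<open>cnj (h x)\<close> below is formally its inverse transform.\<close>
  define g_a where "g_a w = fchar (a \<bullet> w) * g w" for w
  have g: "g \<in> L2"
    using \<phi> by (simp add: is_fourier_L2_def)
  have "g_a \<in> L2"
    unfolding g_a_def[abs_def] by (rule L2_fchar_mult[OF g])
  then have "(\<lambda>w. cnj (g_a w)) \<in> L2"
    by (rule L2_cnj)
  then obtain h where h: "is_fourier_L2 (\<lambda>w. cnj (g_a w)) h"
    using is_fourier_L2_exists by blast
  show ?thesis
  proof (rule that[of "\<lambda>x. cnj (h x)"])
    show "(\<lambda>x. cnj (h x)) \<in> L2"
      using h by (auto simp: is_fourier_L2_def intro: L2_cnj)
    have "L2_norm (\<lambda>x. cnj (h x)) = L2_norm h"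
      by (simp add: L2_norm_def)
    also have "\<dots> \<le> L2_norm (\<lambda>w. cnj (g_a w))"
      by (rule is_fourier_L2_norm_le[OF h])
    also have "\<dots> = L2_norm g"
      by (simp add: L2_norm_def g_a_def norm_mult)
    also have "\<dots> \<le> L2_norm \<phi>"
      by (rule is_fourier_L2_norm_le[OF \<phi>])
    finally show "L2_norm (\<lambda>x. cnj (h x)) \<le> L2_norm \<phi>" .
    fix b
    have "L2_inner (\<lambda>x. cnj (h x)) (translate b \<phi>) = cnj (LINT x|lborel. h x * translate b \<phi> x)"
      by (simp add: L2_inner_def flip: complex_cnj_mult)
    also have "(LINT x|lborel. h x * translate b \<phi> x) =
        (LINT w|lborel. cnj (g_a w) * (fchar (b \<bullet> w) * g w))"
      by (rule is_fourier_L2_multiplication[OF h is_fourier_L2_translate[OF \<phi>]])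
    also have "cnj \<dots> = (LINT w|lborel. g_a w * cnj (fchar (b \<bullet> w) * g w))"
      by (subst Bochner_Integration.integral_cnj[symmetric]) simp
    also have "\<dots> = fourier_L1 (\<lambda>w. complex_of_real ((cmod (g w))\<^sup>2)) (a - b)"
      unfolding fourier_L1_fchar
    proof (intro Bochner_Integration.integral_cong refl)
      fix w
      \<comment> \<open>Conjugating the character of b inverts it, which is where the difference a -
        b arises.\<close>
      have "fchar (w \<bullet> (a - b)) = fchar (a \<bullet> w) * cnj (fchar (b \<bullet> w))"
        unfolding cnj_fchar fchar_add[symmetric] by (simp add: inner_diff_right inner_commute)
      then show "g_a w * cnj (fchar (b \<bullet> w) * g w) =
          complex_of_real ((cmod (g w))\<^sup>2) * fchar (w \<bullet> (a - b))"
        unfolding complex_norm_square by (simp add: g_a_def mult_ac)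
    qed
    finally show "L2_inner (\<lambda>x. cnj (h x)) (translate b \<phi>) =
        fourier_L1 (\<lambda>w. complex_of_real ((cmod (g w))\<^sup>2)) (a - b)" .
  qed
qed

theorem corollary4p3:
  fixes \<phi> :: "real ^ 'd \<Rightarrow> complex"
    and \<Phi> :: "real ^ 'd \<Rightarrow> complex"
    and lam :: "int \<Rightarrow> real ^ 'd"
  assumes "\<phi> \<in> L2"
    and "\<Phi> = (\<lambda>w. complex_of_real ((cmod (fourier_L2 \<phi> w))\<^sup>2))"
    and "Bessel_sequence (\<lambda>k. translate (lam k) \<phi>)"
  shows "(SUP k. \<Sum>\<^sub>\<infinity>l\<in>UNIV. ennreal ((cmod (fourier_L1 \<Phi> (lam k - lam l)))\<^sup>2)) < \<infinity>"
proof -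
  obtain B where B: "0 < B" "\<And>f. f \<in> L2 \<Longrightarrow>
      (\<Sum>\<^sub>\<infinity>l\<in>UNIV. ennreal ((cmod (L2_inner f (translate (lam l) \<phi>)))\<^sup>2)) \<le> ennreal (B * (L2_norm f)\<^sup>2)"
    using assms(3) unfolding Bessel_sequence_def by blast
  have "(\<Sum>\<^sub>\<infinity>l\<in>UNIV. ennreal ((cmod (fourier_L1 \<Phi> (lam k - lam l)))\<^sup>2)) \<le> ennreal (B * (L2_norm \<phi>)\<^sup>2)" for k
  proof -
    obtain f where f: "f \<in> L2" "L2_norm f \<le> L2_norm \<phi>"
      "\<And>b. L2_inner f (translate b \<phi>) = fourier_L1 \<Phi> (lam k - b)"
      using fourier_L1_norm_square_representation[OF is_fourier_L2_fourier_L2[OF assms(1)], of "lam k"]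
      unfolding assms(2) by blast
    have "(\<Sum>\<^sub>\<infinity>l\<in>UNIV. ennreal ((cmod (fourier_L1 \<Phi> (lam k - lam l)))\<^sup>2)) \<le> ennreal (B * (L2_norm f)\<^sup>2)"
      using B(2)[OF f(1)] by (simp only: f(3))
    also have "\<dots> \<le> ennreal (B * (L2_norm \<phi>)\<^sup>2)"
      using B(1) f(2) by (intro ennreal_leI mult_left_mono power_mono) auto
    finally show ?thesis .
  qed
  then have "(SUP k. \<Sum>\<^sub>\<infinity>l\<in>UNIV. ennreal ((cmod (fourier_L1 \<Phi> (lam k - lam l)))\<^sup>2)) \<le> ennreal (B * (L2_norm \<phi>)\<^sup>2)"
    by (intro SUP_least)
  also have "\<dots> < \<infinity>"
    by simp
  finally show ?thesis .
qed

end
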